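(* Let $n$ be a positive integer. The inequalities $$x_{i\ell}+X_{ik,jk}+X_{jk,j\ell}\le x_{ik}+x_{j\ell}+X_{ij,k\ell}+X_{i\ell,jk}\qquad\text{for all } 1\le i<j<k<\ell\le n$$ are valid inequalities for the semidefinite relaxation of the minimum cutwidth problem on $n$ vertices; that is, for every permutation $\pi$ of $\{1,\dots,n\}$, they are all satisfied by $x=\chi^\pi$ and $X=\chi^\pi(\chi^\pi)^\top$.
   Context: For a permutation $\pi$ of $\{1,\dots,n\}$, where $\pi(v)$ is the position of $v$ in the linear ordering, the vector $\chi^\pi=(\chi^\pi_{ij})_{1\le i<j\le n}\in\{0,1\}^{\binom n2}$ is defined by $\chi^\pi_{ij}=1$ if $\pi(i)<\pi(j)$ and $\chi^\pi_{ij}=0$ otherwise. The minimum cutwidth problem for a graph with vertex set $\{1,\dots,n\}$ asks for a permutation $\pi$ minimizing $\max_v CW_\pi(v)$, where $CW_\pi(v)$ is the number of edges $\{u,w\}$ with $\pi(u)\le\pi(v)<\pi(w)$. In its semidefinite relaxation the variables are a vector $x=(x_{ij})_{1\le i<j\le n}$ and a symmetric matrix $X=(X_{ij,k\ell})_{1\le i<j\le n,\,1\le k<\ell\le n}$ with $x=\operatorname{diag}(X)$, where $x$ represents $\chi^\pi$ and the entry $X_{ij,k\ell}$ represents the product $x_{ij}x_{k\ell}$. An inequality in $(x,X)$ is called valid for the relaxation if it is satisfied by $x=\chi^\pi$, $X=\chi^\pi(\chi^\pi)^\top$ for every permutation $\pi$ of $\{1,\dots,n\}$, i.e. adding it to the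 relaxation does not cut off any matrix representing a permutation. *)

theory Defs
  imports Complex_Main "HOL-Library.FuncSet" "HOL-Combinatorics.Permutations"
begin

definition pairs :: "nat \<Rightarrow> (nat \<times> nat) set" where
  "pairs n = {(i, j). 1 \<le> i \<and> i < j \<and> j \<le> n}"

text \<open>
  Vectors and matrices indexed by \<open>pairs n\<close> are extensional functions: their
  values off the index set are \<open>undefined\<close>.
\<close>

type_synonym pair_vector = "nat \<times> nat \<Rightarrow> real"
type_synonym pair_matrix = "nat \<times> nat \<Rightarrow> nat \<times> nat \<Rightarrow> real"

text \<open>\<open>\<pi> v\<close> is the position of the vertex \<open>v\<close> in the linear ordering.\<close>

definition chi :: "nat \<Rightarrow> (nat \<Rightarrow> nat) \<Rightarrow> pair_vector" where
  "chi n \<pi> = restrict (\<lambda>(i, j). if \<pi> i < \<pi> j then 1 else 0) (pairs n)"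

definition outer_product :: "nat \<Rightarrow> pair_vector \<Rightarrow> pair_matrix" where
  "outer_product n x = (\<lambda>e \<in> pairs n. \<lambda>f \<in> pairs n. x e * x f)"

text \<open>
  An inequality in \<open>(x, X)\<close> is represented by the predicate that says it holds. It is
  valid if it cuts off no point representing a permutation, so the notion does not
  depend on the edge set of the graph.
\<close>

definition valid_for_cutwidth_relaxation ::
    "nat \<Rightarrow> (pair_vector \<Rightarrow> pair_matrix \<Rightarrow> bool) \<Rightarrow> bool" where
  "valid_for_cutwidth_relaxation n ineq \<longleftrightarrow>
     (\<forall>\<pi>. \<pi> permutes {1..n} \<longrightarrow> ineq (chi n \<pi>) (outer_product n (chi n \<pi>)))"

end

theory Submission
  imports Defs
begin

text \<open>
  Case distinction on the factor \<open>x\<^bsub>jk\<^esub>\<close>, which occurs in three of the four products.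
  If \<open>x\<^bsub>jk\<^esub> = 1\<close>, these products become \<open>x\<^bsub>ik\<^esub>\<close>, \<open>x\<^bsub>jl\<^esub>\<close> and \<open>x\<^bsub>il\<^esub>\<close>, everything linear
  cancels, and \<open>0 \<le> x\<^bsub>ij\<^esub> x\<^bsub>kl\<^esub>\<close> remains. If \<open>x\<^bsub>jk\<^esub> = 0\<close>, what remains is
  \<open>x\<^bsub>il\<^esub> \<le> x\<^bsub>ik\<^esub> + x\<^bsub>jl\<^esub> + x\<^bsub>ij\<^esub> x\<^bsub>kl\<^esub>\<close>. It could only fail if \<open>i\<close> precedes \<open>l\<close> while \<open>i\<close> does
  not precede \<open>k\<close> and \<open>j\<close> does not precede \<open>l\<close>; but then the order is \<open>k, i, l, j\<close>, so
  \<open>x\<^bsub>ij\<^esub> = x\<^bsub>kl\<^esub> = 1\<close>.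
\<close>

theorem lemma2p2:
  fixes n i j k l :: nat
  assumes "n \<ge> 1"
    and "1 \<le> i" and "i < j" and "j < k" and "k < l" and "l \<le> n"
  shows "valid_for_cutwidth_relaxation n (\<lambda>x X.
           x (i, l) + X (i, k) (j, k) + X (j, k) (j, l)
             \<le> x (i, k) + x (j, l) + X (i, j) (k, l) + X (i, l) (j, k))"
  unfolding valid_for_cutwidth_relaxation_def
proof (intro allI impI)
  fix \<pi> :: "nat \<Rightarrow> nat"
  let ?x = "chi n \<pi>" and ?X = "outer_product n (chi n \<pi>)"
  have in_pairs: "(i, j) \<in> pairs n" "(i, k) \<in> pairs n" "(i, l) \<in> pairs n"
      "(j, k) \<in> pairs n" "(j, l) \<in> pairs n" "(k, l) \<in> pairs n"
    using assms by (auto simp: pairs_def)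
  have x: "?x (u, v) = (if \<pi> u < \<pi> v then 1 else 0)" if "(u, v) \<in> pairs n" for u v
    using that by (simp add: chi_def)
  have X: "?X e f = ?x e * ?x f" if "e \<in> pairs n" "f \<in> pairs n" for e f
    using that by (simp add: outer_product_def)
  show "?x (i, l) + ?X (i, k) (j, k) + ?X (j, k) (j, l)
          \<le> ?x (i, k) + ?x (j, l) + ?X (i, j) (k, l) + ?X (i, l) (j, k)"
  proof (cases "\<pi> j < \<pi> k")
    case True
    then show ?thesis
      by (simp add: x X in_pairs)
  next
    case False
    have "\<pi> i < \<pi> j \<and> \<pi> k < \<pi> l" if "\<pi> i < \<pi> l" "\<not> \<pi> i < \<pi> k" "\<not> \<pi> j < \<pi> l"
      using that by linarith
    with False show ?thesis
      by (auto simp: x X in_pairs)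
  qed
qed

end
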